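(* Under external placement, the Counter-based Causal Monitor algorithm (in either mode $\textsc{FAInc}$ or $\textsc{Striped}$) is sound for the Causal Observability Problem: in every execution and for all operations $\mathit{op}_A,\mathit{op}_B$ (with identifiers $A,B$), $$\mathrm{Precedes}(A,B)=\mathtt{true}\;\Rightarrow\;\mathit{op}_A<_H\mathit{op}_B .$$
   Context: **Model.** $N$ asynchronous processes $p_1,\dots,p_N$ communicate through atomic shared memory. $e\prec f$ means event $e$ occurs before event $f$ in real time; no two events are simultaneous. Operations $\mathit{op}$ of a target algorithm, each with a unique identifier, are executed by the processes; $\mathrm{inv}(\mathit{op})$ and $\mathrm{res}(\mathit{op})$ are their invocation and response events. $\mathit{op}_A<_H\mathit{op}_B$ iff $\mathrm{res}(\mathit{op}_A)\prec\mathrm{inv}(\mathit{op}_B)$. **External placement.** The process executing $\mathit{op}$ with identifier $\mathit{id}$ calls $\mathrm{Add\_Inv}(\mathit{id})$, and this call returns before $\mathrm{inv}(\mathit{op})$; it calls $\mathrm{Add\_Res}(\mathit{id})$ after $\mathrm{res}(\mathit{op})$. $\mathrm{Precedes}(A,B)$ is queried only when the response records of both $A$ and $B$ have been written. **Counter-based algorithm.** Shared: single-writer multi-reader append-only registers $\mathrm{Reg}[1..N]$ ($\mathrm{Reg}[i]$ written only by $p_i$), initially empty, and a counter $C$ initially $0$. Procedure $\mathrm{Stamp}()$: - mode $\textsc{FAInc}$: atomically fetch-and-increment $C$ and return the fetched value; - mode $\textsc{Striped}$: $C$ is an array of atomic cells $C[1..N]$, initially $0$; process $p_i$ first atomically increments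 $C[i]$ by one, and afterwards reads all cells one at a time (non-atomically) and returns the sum of the values read. $\mathrm{Add\_Inv}(\mathit{id})$ by $p_i$: $t\gets\mathrm{Stamp}()$, then append $(I,\mathit{id},t)$ to $\mathrm{Reg}[i]$. $\mathrm{Add\_Res}(\mathit{id})$ by $p_i$: $t\gets\mathrm{Stamp}()$, then append $(R,\mathit{id},t)$ to $\mathrm{Reg}[i]$. $\mathrm{Precedes}(A,B)$: let $t_A$ be the timestamp stored with $(R,A)$ and $t_B$ the timestamp stored with $(I,B)$; return $t_A<t_B$. *)

theory Defs
  imports Main
begin

text \<open>
  Processes are the numbers \<open>1, \<dots>, N\<close>. An execution is the finite sequence of its atomic
  events, listed in real-time order; every event carries the process that performs it.
  Finite sequences suffice: an answer of a query in an infinite execution is already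
  part of a finite prefix, and so are the two events related by the real-time order.
\<close>

datatype mode = FAInc | Striped

text \<open>\<open>I\<close> and \<open>R\<close> are the tags of invocation and response records.\<close>
datatype tag = I | R

type_synonym 'id entry = "tag \<times> 'id \<times> nat"

text \<open>
  \<open>Call_Add I id\<close> and \<open>Ret_Add I id\<close> are the call and the return of \<open>Add_Inv(id)\<close>, and those
  with tag \<open>R\<close> belong to \<open>Add_Res(id)\<close>. \<open>Target_Step\<close> is any step of the target algorithm
  (or of the rest of the program) other than an invocation or a response; it does not touch
  the shared variables of the monitor.
\<close>
datatype 'id action =
    Inv 'id
  | Res 'id
  | Target_Step
  | Call_Add tag 'id
  | Fetch_Inc
  | Inc_Cell
  | Read_Cell nat
  | Return_Sum
  | Append "'id entry"
  | Ret_Add tag 'id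
  | Call_Precedes 'id 'id
  | Read_Reg nat
  | Ret_Precedes 'id 'id bool

type_synonym 'id event = "nat \<times> 'id action"

text \<open>
  Control state of a process: \<open>Idle\<close> means that it is outside the monitor's code.
  In \<open>Summing x id D v\<close>, \<open>D\<close> is the set of cells not read yet and \<open>v\<close> the sum of the values
  read so far.
\<close>
datatype 'id control =
    Idle
  | Stamping tag 'id
  | Summing tag 'id "nat set" nat
  | Stamped tag 'id nat
  | Appended tag 'id
  | Seek_Res 'id 'id
  | Seek_Inv 'id 'id nat
  | Found 'id 'id nat nat

record 'id state =
  reg :: "nat \<Rightarrow> 'id entry list"
  counter :: nat
  cell :: "nat \<Rightarrow> nat"
  ctrl :: "nat \<Rightarrow> 'id control"

definition initial :: "'id state" where
  "initial = \<lparr>reg = (\<lambda>_. []), counter = 0, cell = (\<lambda>_. 0), ctrl = (\<lambda>_. Idle)\<rparr>"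

abbreviation goto :: "nat \<Rightarrow> 'id control \<Rightarrow> 'id state \<Rightarrow> 'id state" where
  "goto p c s \<equiv> s\<lparr>ctrl := (ctrl s)(p := c)\<rparr>"

text \<open>
  The cells are read in an arbitrary order. A query looks for its two records by atomic reads
  of single registers, in an arbitrary order and possibly with unsuccessful reads.
\<close>
inductive step :: "mode \<Rightarrow> nat \<Rightarrow> 'id state \<Rightarrow> 'id event \<Rightarrow> 'id state \<Rightarrow> bool"
  for m :: mode and N :: nat
where
  inv: "p \<in> {1..N} \<Longrightarrow> ctrl s p = Idle \<Longrightarrow> step m N s (p, Inv x) s"
| res: "p \<in> {1..N} \<Longrightarrow> ctrl s p = Idle \<Longrightarrow> step m N s (p, Res x) s"
| target: "p \<in> {1..N} \<Longrightarrow> ctrl s p = Idle \<Longrightarrow> step m N s (p, Target_Step) s"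

| call_add: "p \<in> {1..N} \<Longrightarrow> ctrl s p = Idle \<Longrightarrow>
    step m N s (p, Call_Add k x) (goto p (Stamping k x) s)"
| fetch_inc: "m = FAInc \<Longrightarrow> p \<in> {1..N} \<Longrightarrow> ctrl s p = Stamping k x \<Longrightarrow>
    step m N s (p, Fetch_Inc)
      (goto p (Stamped k x (counter s)) (s\<lparr>counter := counter s + 1\<rparr>))"
| inc_cell: "m = Striped \<Longrightarrow> p \<in> {1..N} \<Longrightarrow> ctrl s p = Stamping k x \<Longrightarrow>
    step m N s (p, Inc_Cell)
      (goto p (Summing k x {1..N} 0) (s\<lparr>cell := (cell s)(p := cell s p + 1)\<rparr>))"
| read_cell: "p \<in> {1..N} \<Longrightarrow> ctrl s p = Summing k x D v \<Longrightarrow> j \<in> D \<Longrightarrow>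
    step m N s (p, Read_Cell j) (goto p (Summing k x (D - {j}) (v + cell s j)) s)"
| return_sum: "p \<in> {1..N} \<Longrightarrow> ctrl s p = Summing k x {} v \<Longrightarrow>
    step m N s (p, Return_Sum) (goto p (Stamped k x v) s)"
| append: "p \<in> {1..N} \<Longrightarrow> ctrl s p = Stamped k x t \<Longrightarrow>
    step m N s (p, Append (k, x, t))
      (goto p (Appended k x) (s\<lparr>reg := (reg s)(p := reg s p @ [(k, x, t)])\<rparr>))"
| ret_add: "p \<in> {1..N} \<Longrightarrow> ctrl s p = Appended k x \<Longrightarrow>
    step m N s (p, Ret_Add k x) (goto p Idle s)"

| call_precedes: "p \<in> {1..N} \<Longrightarrow> ctrl s p = Idle \<Longrightarrow>
    step m N s (p, Call_Precedes A B) (goto p (Seek_Res A B) s)"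
| read_res: "p \<in> {1..N} \<Longrightarrow> ctrl s p = Seek_Res A B \<Longrightarrow> j \<in> {1..N} \<Longrightarrow>
    (R, A, tA) \<in> set (reg s j) \<Longrightarrow>
    step m N s (p, Read_Reg j) (goto p (Seek_Inv A B tA) s)"
| miss_res: "p \<in> {1..N} \<Longrightarrow> ctrl s p = Seek_Res A B \<Longrightarrow> j \<in> {1..N} \<Longrightarrow>
    (\<nexists>tA. (R, A, tA) \<in> set (reg s j)) \<Longrightarrow>
    step m N s (p, Read_Reg j) s"
| read_inv: "p \<in> {1..N} \<Longrightarrow> ctrl s p = Seek_Inv A B tA \<Longrightarrow> j \<in> {1..N} \<Longrightarrow>
    (I, B, tB) \<in> set (reg s j) \<Longrightarrow>
    step m N s (p, Read_Reg j) (goto p (Found A B tA tB) s)"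
| miss_inv: "p \<in> {1..N} \<Longrightarrow> ctrl s p = Seek_Inv A B tA \<Longrightarrow> j \<in> {1..N} \<Longrightarrow>
    (\<nexists>tB. (I, B, tB) \<in> set (reg s j)) \<Longrightarrow>
    step m N s (p, Read_Reg j) s"
| ret_precedes: "p \<in> {1..N} \<Longrightarrow> ctrl s p = Found A B tA tB \<Longrightarrow>
    step m N s (p, Ret_Precedes A B (tA < tB)) (goto p Idle s)"

inductive run :: "mode \<Rightarrow> nat \<Rightarrow> 'id event list \<Rightarrow> 'id state \<Rightarrow> bool"
  for m :: mode and N :: nat
where
  start: "run m N [] initial"
| snoc: "run m N es s \<Longrightarrow> step m N s e s' \<Longrightarrow> run m N (es @ [e]) s'"

definition execution :: "mode \<Rightarrow> nat \<Rightarrow> 'id event list \<Rightarrow> bool" where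
  "execution m N es \<longleftrightarrow> (\<exists>s. run m N es s)"

definition at_most_once :: "'id event list \<Rightarrow> 'id action \<Rightarrow> bool" where
  "at_most_once es a \<longleftrightarrow>
    (\<forall>i < length es. \<forall>j < length es. snd (es ! i) = a \<and> snd (es ! j) = a \<longrightarrow> i = j)"

definition operations_wf :: "'id event list \<Rightarrow> bool" where
  "operations_wf es \<longleftrightarrow>
    (\<forall>x. at_most_once es (Inv x) \<and> at_most_once es (Res x)) \<and>
    (\<forall>x p. \<forall>j < length es. es ! j = (p, Res x) \<longrightarrow> (\<exists>i < j. es ! i = (p, Inv x)))"

text \<open>
  Each operation has one \<open>Add_Inv\<close> and one \<open>Add_Res\<close> call, made by its own process. The calls
  are only bounded from above because an operation may be incomplete in \<open>es\<close>.
\<close>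
definition external_placement :: "'id event list \<Rightarrow> bool" where
  "external_placement es \<longleftrightarrow>
    (\<forall>k x. at_most_once es (Call_Add k x)) \<and>
    (\<forall>x p. \<forall>j < length es. es ! j = (p, Inv x) \<longrightarrow> (\<exists>i < j. es ! i = (p, Ret_Add I x))) \<and>
    (\<forall>x p. \<forall>j < length es. es ! j = (p, Call_Add R x) \<longrightarrow> (\<exists>i < j. es ! i = (p, Res x))) \<and>
    (\<forall>A B p. \<forall>j < length es. es ! j = (p, Call_Precedes A B) \<longrightarrow>
      (\<exists>i < j. \<exists>q t. es ! i = (q, Append (R, A, t))) \<and>
      (\<exists>i < j. \<exists>q t. es ! i = (q, Append (R, B, t))))"

text \<open>The real-time order \<open>op\<^sub>A <\<^sub>H op\<^sub>B\<close>.\<close>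
definition real_time_before :: "'id event list \<Rightarrow> 'id \<Rightarrow> 'id \<Rightarrow> bool" where
  "real_time_before es A B \<longleftrightarrow>
    (\<exists>i j p q. i < j \<and> j < length es \<and> es ! i = (p, Res A) \<and> es ! j = (q, Inv B))"

end

(*
  Suppose that Precedes(A, B) answers true but inv(B) comes before res(A), and let T be the
  value of the clock (the counter, or the sum of all cells) at inv(B). The only call
  Add_Inv(B) has then returned. A stamp never exceeds the clock at the moment it is returned,
  because the clock is a sum of monotone cells, so the timestamp of (I, B) is at most T. The
  only call Add_Res(A) has not begun. Every cell that it reads is at least as large as it
  was at inv(B), so the timestamp of (R, A) is at least T. This contradicts the answer.
*)
theory Submission
  imports Defs
begin

section \<open>Vocabulary, and cutting a run in two\<close>

abbreviation actions :: "'id event list \<Rightarrow> 'id action set" where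
  "actions es \<equiv> snd ` set es"

text \<open>\<open>Appended\<close> is included, so a call stays pending from
  \<open>Call_Add\<close> until \<open>Ret_Add\<close>, even when its record is already
  written.\<close>

fun pending :: "'id control \<Rightarrow> (tag \<times> 'id) set" where
  "pending (Stamping k x) = {(k, x)}"
| "pending (Summing k x D v) = {(k, x)}"
| "pending (Stamped k x t) = {(k, x)}"
| "pending (Appended k x) = {(k, x)}"
| "pending _ = {}"

fun query :: "'id control \<Rightarrow> ('id \<times> 'id) set" where
  "query (Seek_Res A B) = {(A, B)}"
| "query (Seek_Inv A B tA) = {(A, B)}"
| "query (Found A B tA tB) = {(A, B)}"
| "query _ = {}"

text \<open>In mode \<open>Striped\<close> this is the instantaneous sum of the cells. No process
  can read it atomically; it serves only as the yardstick for stamps.\<close>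

definition clock :: "mode \<Rightarrow> nat \<Rightarrow> 'id state \<Rightarrow> nat" where
  "clock m N s = (case m of FAInc \<Rightarrow> counter s | Striped \<Rightarrow> sum (cell s) {1..N})"

lemma at_most_once_appendD:
  assumes "at_most_once (us @ vs) a" and "a \<in> actions us"
  shows "a \<notin> actions vs"
proof
  assume "a \<in> actions vs"
  then obtain j where j: "j < length vs" "snd (vs ! j) = a"
    by (auto simp: in_set_conv_nth)
  from assms(2) obtain i where i: "i < length us" "snd (us ! i) = a"
    by (auto simp: in_set_conv_nth)
  have "i = length us + j"
    using assms(1) i j unfolding at_most_once_def
    by (auto simp: nth_append dest!: spec[of _ i] spec[of _ "length us + j"])
  with i show False by simp
qed

lemma at_most_once_prefix: "at_most_once (us @ vs) a \<Longrightarrow> at_most_once us a"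
  unfolding at_most_once_def
  by (metis nth_append length_append trans_less_add1)

text \<open>Induction along the second half of a run. The premise \<open>e \<in> set vs\<close>
  admits invariants that only the steps of this half need to preserve. The state \<open>s0\<close>
  is chosen before \<open>P\<close>, so several invariants can start from the same cut.\<close>

lemma run_append_invariant:
  assumes "run m N (us @ vs) s"
  obtains s0 where "run m N us s0"
    and "\<And>P. P s0 \<Longrightarrow>
      (\<And>s e s'. e \<in> set vs \<Longrightarrow> step m N s e s' \<Longrightarrow> P s \<Longrightarrow> P s') \<Longrightarrow> P s"
proof -
  have "\<exists>s0. run m N us s0 \<and> (\<forall>P. P s0 \<longrightarrow>
      (\<forall>s e s'. e \<in> set vs \<longrightarrow> step m N s e s' \<longrightarrow> P s \<longrightarrow> P s') \<longrightarrow> P s)"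
    using assms
  proof (induction vs arbitrary: s rule: rev_induct)
    case Nil
    then show ?case by auto
  next
    case (snoc e vs)
    from snoc.prems obtain s1 where s1: "run m N (us @ vs) s1" "step m N s1 e s"
      by (cases rule: run.cases) (auto simp flip: append_assoc)
    from snoc.IH[OF s1(1)] obtain s0 where s0: "run m N us s0"
      "\<And>P. P s0 \<Longrightarrow>
        (\<And>s e s'. e \<in> set vs \<Longrightarrow> step m N s e s' \<Longrightarrow> P s \<Longrightarrow> P s') \<Longrightarrow> P s1"
      by metis
    have "P s" if "P s0"
      "\<And>s e' s'. e' \<in> set (vs @ [e]) \<Longrightarrow> step m N s e' s' \<Longrightarrow> P s \<Longrightarrow> P s'" for P
    proof -
      have "P s1" by (rule s0(2)) (use that in auto)
      then show ?thesis using that(2)[OF _ s1(2)] by simp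
    qed
    with s0(1) show ?case by blast
  qed
  then show thesis using that by blast
qed

subsection \<open>Control states and the history\<close>

lemma step_pending:
  assumes "step m N s e s'" and "(k, x) \<in> pending (ctrl s' p)"
  shows "(k, x) \<in> pending (ctrl s p) \<or> e = (p, Call_Add k x)"
  using assms by cases (auto split: if_splits)

lemma step_record:
  assumes "step m N s e s'" and "(k, x, t) \<in> set (reg s' p)"
  shows "(k, x, t) \<in> set (reg s p) \<or> ctrl s p = Stamped k x t"
  using assms by cases (auto split: if_splits)

lemma step_return:
  assumes "step m N s (p, Ret_Add k x) s'"
  shows "(k, x) \<in> pending (ctrl s p)" and "(k, x) \<notin> pending (ctrl s' p)"
  using assms by (cases; simp)+

lemma step_append:
  assumes "step m N s (p, Append (k, x, t)) s'"
  shows "(k, x) \<in> pending (ctrl s p)"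
  using assms by cases simp

lemma step_query:
  assumes "step m N s e s'" and "(A, B) \<in> query (ctrl s' p)"
  shows "(A, B) \<in> query (ctrl s p) \<or> e = (p, Call_Precedes A B)"
  using assms by cases (auto split: if_splits)

lemma step_seek_inv:
  assumes "step m N s e s'" and "ctrl s' p = Seek_Inv A B tA"
  shows "ctrl s p = Seek_Inv A B tA \<or> (\<exists>i. (R, A, tA) \<in> set (reg s i))"
  using assms by cases (auto split: if_splits)

lemma step_found:
  assumes "step m N s e s'" and "ctrl s' p = Found A B tA tB"
  shows "ctrl s p = Found A B tA tB \<or>
    ctrl s p = Seek_Inv A B tA \<and> (\<exists>j. (I, B, tB) \<in> set (reg s j))"
  using assms by cases (auto split: if_splits)

lemma step_answer:
  assumes "step m N s (p, Ret_Precedes A B c) s'"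
  obtains tA tB where "ctrl s p = Found A B tA tB" and "c \<longleftrightarrow> tA < tB"
  using assms by cases simp

lemma step_reg_mono: "step m N s e s' \<Longrightarrow> set (reg s p) \<subseteq> set (reg s' p)"
  by (erule step.cases) auto

lemma actions_snoc: "a \<in> actions (es @ [e]) \<longleftrightarrow> a \<in> actions es \<or> snd e = a"
  by auto

text \<open>The two claims share one induction: a new record comes from a \<open>Stamped\<close>
  control state, which is itself pending.\<close>

lemma call_of_pending_or_record:
  assumes "run m N es s"
  shows "((k, x) \<in> pending (ctrl s p) \<longrightarrow> Call_Add k x \<in> actions es) \<and>
    ((k, x, t) \<in> set (reg s p) \<longrightarrow> Call_Add k x \<in> actions es)"
  using assms
proof induction
  case start
  show ?case by (simp add: initial_def)
next
  case (snoc es s e s')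
  have "Call_Add k x \<in> actions es" if "ctrl s p = Stamped k x t"
    using that snoc.IH by simp
  then show ?case
    using step_pending[OF snoc.hyps(2), of k x p] step_record[OF snoc.hyps(2), of k x t p]
      snoc.IH
    unfolding actions_snoc by auto
qed

lemma call_of_append_or_return:
  assumes "run m N es s"
  shows "Append (k, x, t) \<in> actions es \<Longrightarrow> Call_Add k x \<in> actions es"
    and "Ret_Add k x \<in> actions es \<Longrightarrow> Call_Add k x \<in> actions es"
proof -
  have "(Append (k, x, t) \<in> actions es \<longrightarrow> Call_Add k x \<in> actions es) \<and>
    (Ret_Add k x \<in> actions es \<longrightarrow> Call_Add k x \<in> actions es)"
    using assms
  proof induction
    case start
    show ?case by simp
  next
    case (snoc es s e s')
    have "Call_Add k x \<in> actions es" if "(k, x) \<in> pending (ctrl s p)" for p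
      using call_of_pending_or_record[OF snoc.hyps(1)] that by blast
    then have "Call_Add k x \<in> actions es" if "snd e = Append (k, x, t) \<or> snd e = Ret_Add k x"
      using that snoc.hyps(2) step_return(1) step_append by (metis prod.collapse)
    then show ?case
      using snoc.IH unfolding actions_snoc by blast
  qed
  then show "Append (k, x, t) \<in> actions es \<Longrightarrow> Call_Add k x \<in> actions es"
    and "Ret_Add k x \<in> actions es \<Longrightarrow> Call_Add k x \<in> actions es"
    by blast+
qed

text \<open>A return closes the call only for the process that performs it. Uniqueness of the
  pending process is therefore carried along, to exclude that another process still has the same
  call open.\<close>

lemma not_pending_after_return:
  assumes "run m N es s" and "at_most_once es (Call_Add k x)"
  shows "((k, x) \<in> pending (ctrl s p) \<and> (k, x) \<in> pending (ctrl s q) \<longrightarrow> p = q) \<and>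
    (Ret_Add k x \<in> actions es \<longrightarrow> (k, x) \<notin> pending (ctrl s p))"
  using assms
proof (induction arbitrary: p q)
  case start
  show ?case by (simp add: initial_def)
next
  case (snoc es s e s')
  note IH = snoc.IH[OF at_most_once_prefix[OF snoc.prems]]
  have called: "Call_Add k x \<in> actions es" if "(k, x) \<in> pending (ctrl s p)" for p
    using call_of_pending_or_record[OF snoc.hyps(1)] that by blast
  note returned = call_of_append_or_return(2)[OF snoc.hyps(1), of k x]
  note pending = step_pending[OF snoc.hyps(2), of k x]
  show ?case
  proof (cases "snd e = Call_Add k x")
    case True
    \<comment> \<open>This call is the first one, so before it nothing was pending and nothing had
      returned.\<close>
    then have "Call_Add k x \<notin> actions es"
      using at_most_once_appendD[OF snoc.prems] by auto
    then show ?thesis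
      using pending[of p] pending[of q] called returned True
      unfolding actions_snoc by auto
  next
    case False
    then have before: "(k, x) \<in> pending (ctrl s r)" if "(k, x) \<in> pending (ctrl s' r)" for r
      using pending[of r] that by auto
    \<comment> \<open>A process still pending after the step was pending before it, hence is the
      returning process by uniqueness; but that process has just become idle.\<close>
    have "(k, x) \<notin> pending (ctrl s' p)" if "snd e = Ret_Add k x"
      using step_return[of m N s "fst e" k x s'] snoc.hyps(2) that before[of p]
        IH[of p "fst e"]
      by (metis prod.collapse)
    then show ?thesis
      using before IH[of p q] unfolding actions_snoc by blast
  qed
qed

section \<open>Queries and their answers\<close>

lemma query_called:
  assumes "run m N es s" and "(A, B) \<in> query (ctrl s p)"
  shows "Call_Precedes A B \<in> actions es"
  using assms
proof (induction arbitrary: p)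
  case start
  then show ?case by (simp add: initial_def)
next
  case (snoc es s e s')
  from step_query[OF snoc.hyps(2) snoc.prems] snoc.IH show ?case
    unfolding actions_snoc by auto
qed

text \<open>A query collects its two stamps at different moments. The invariant survives the steps
  in between because registers are append-only.\<close>

definition query_sound :: "'id state \<Rightarrow> bool" where
  "query_sound s \<longleftrightarrow>
    (\<forall>p A B tA. ctrl s p = Seek_Inv A B tA \<longrightarrow> (\<exists>i. (R, A, tA) \<in> set (reg s i))) \<and>
    (\<forall>p A B tA tB. ctrl s p = Found A B tA tB \<longrightarrow>
      (\<exists>i. (R, A, tA) \<in> set (reg s i)) \<and> (\<exists>j. (I, B, tB) \<in> set (reg s j)))"

lemma step_query_sound:
  assumes "step m N s e s'" and "query_sound s"
  shows "query_sound s'"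
proof -
  note inv = assms(2)[unfolded query_sound_def]
  have mono: "\<exists>i. r \<in> set (reg s' i)" if "\<exists>i. r \<in> set (reg s i)" for r
    using that step_reg_mono[OF assms(1)] by blast
  have "\<exists>i. (R, A, tA) \<in> set (reg s i)" if "ctrl s' p = Seek_Inv A B tA" for p A B tA
    using step_seek_inv[OF assms(1) that] inv by blast
  moreover have "(\<exists>i. (R, A, tA) \<in> set (reg s i)) \<and> (\<exists>j. (I, B, tB) \<in> set (reg s j))"
    if "ctrl s' p = Found A B tA tB" for p A B tA tB
    using step_found[OF assms(1) that] inv by blast
  ultimately show ?thesis
    unfolding query_sound_def using mono by blast
qed

lemma run_query_sound: "run m N es s \<Longrightarrow> query_sound s"
proof (induction rule: run.induct)
  case start
  show ?case by (simp add: query_sound_def initial_def)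
qed (rule step_query_sound)

text \<open>The records behind an answer persist to the end of the run, so both stamps can be
  compared in the single state \<open>s\<close>.\<close>

lemma answer_true:
  assumes "run m N es s" and "Ret_Precedes A B True \<in> actions es"
  shows "Call_Precedes A B \<in> actions es \<and> (\<exists>tA tB i j. tA < tB \<and>
    (R, A, tA) \<in> set (reg s i) \<and> (I, B, tB) \<in> set (reg s j))"
  using assms
proof induction
  case start
  then show ?case by simp
next
  case (snoc es s e s')
  have "Call_Precedes A B \<in> actions es \<and> (\<exists>tA tB i j. tA < tB \<and>
    (R, A, tA) \<in> set (reg s i) \<and> (I, B, tB) \<in> set (reg s j))"
  proof (cases "Ret_Precedes A B True \<in> actions es")
    case True
    then show ?thesis using snoc.IH by simp
  next
    case False
    then obtain p where "e = (p, Ret_Precedes A B True)"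
      using snoc.prems unfolding actions_snoc by (metis prod.collapse)
    with snoc.hyps(2) obtain tA tB where found: "ctrl s p = Found A B tA tB" "tA < tB"
      by (auto elim: step_answer)
    then have "Call_Precedes A B \<in> actions es"
      using query_called[OF snoc.hyps(1), of A B p] by simp
    moreover obtain i j where "(R, A, tA) \<in> set (reg s i)" "(I, B, tB) \<in> set (reg s j)"
      using run_query_sound[OF snoc.hyps(1)] found(1) unfolding query_sound_def by blast
    ultimately show ?thesis using found(2) by blast
  qed
  then obtain tA tB i j where "Call_Precedes A B \<in> actions es" "tA < tB"
    "(R, A, tA) \<in> set (reg s i)" "(I, B, tB) \<in> set (reg s j)"
    by blast
  moreover from this have "(R, A, tA) \<in> set (reg s' i)" "(I, B, tB) \<in> set (reg s' j)"
    using step_reg_mono[OF snoc.hyps(2)] by blast+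
  ultimately show ?case
    unfolding actions_snoc by blast
qed

subsection \<open>Stamps and the clock\<close>

lemma sum_upd_le:
  fixes f :: "nat \<Rightarrow> nat"
  shows "sum f D \<le> sum (f(p := Suc (f p))) D"
  by (rule sum_mono) auto

lemma step_clock_mono: "step m N s e s' \<Longrightarrow> clock m N s \<le> clock m N s'"
  by (erule step.cases) (auto simp: clock_def intro!: sum_mono split: mode.splits)

text \<open>The last clause bounds a partial sum by the current contents of the cells already read,
  which can only have grown since. Once \<open>D\<close> is empty, this bound is the clock.\<close>

definition stamps_le_clock :: "mode \<Rightarrow> nat \<Rightarrow> 'id state \<Rightarrow> bool" where
  "stamps_le_clock m N s \<longleftrightarrow>
    (\<forall>p k x t. (k, x, t) \<in> set (reg s p) \<longrightarrow> t \<le> clock m N s) \<and>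
    (\<forall>p k x t. ctrl s p = Stamped k x t \<longrightarrow> t \<le> clock m N s) \<and>
    (\<forall>p k x D v. ctrl s p = Summing k x D v \<longrightarrow>
      m = Striped \<and> D \<subseteq> {1..N} \<and> v \<le> sum (cell s) ({1..N} - D))"

lemma step_stamps_le_clock:
  assumes "step m N s e s'" and "stamps_le_clock m N s"
  shows "stamps_le_clock m N s'"
proof -
  note inv = assms(2)[unfolded stamps_le_clock_def]
  have mono: "t \<le> clock m N s'" if "t \<le> clock m N s" for t
    using step_clock_mono[OF assms(1)] that by simp
  from assms(1) show ?thesis
  proof cases
    case (inc_cell p k x)
    have "v \<le> sum (cell s') ({1..N} - D)" if "v \<le> sum (cell s) ({1..N} - D)" for v D
      using that sum_upd_le[of "cell s" "{1..N} - D" p] inc_cell by simp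
    then show ?thesis
      using inv mono inc_cell unfolding stamps_le_clock_def by auto
  next
    case (read_cell p k x D v j)
    have D: "m = Striped" "D \<subseteq> {1..N}" "v \<le> sum (cell s) ({1..N} - D)"
      using inv read_cell by blast+
    \<comment> \<open>Reading cell \<open>j\<close> adds its current value to both sides of the
      bound.\<close>
    have "{1..N} - (D - {j}) = insert j ({1..N} - D)"
      using D(2) \<open>j \<in> D\<close> by auto
    then have "v + cell s j \<le> sum (cell s) ({1..N} - (D - {j}))"
      using D(3) \<open>j \<in> D\<close> by simp
    then show ?thesis
      using inv mono read_cell unfolding stamps_le_clock_def
      by (auto dest: subsetD[OF D(2)])
  next
    case (return_sum p k x v)
    have "m = Striped \<and> v \<le> sum (cell s) ({1..N} - {})"
      using inv return_sum by blast
    then have "v \<le> clock m N s" by (simp add: clock_def)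
    then show ?thesis
      using inv mono return_sum unfolding stamps_le_clock_def by auto
  next
    case (fetch_inc p k x)
    \<comment> \<open>The stamp is the fetched value, one below the new clock.\<close>
    then have "counter s \<le> clock m N s'" by (simp add: clock_def)
    then show ?thesis
      using inv mono fetch_inc unfolding stamps_le_clock_def by auto
  qed (use inv mono in \<open>auto simp: stamps_le_clock_def\<close>)
qed

lemma run_stamps_le_clock: "run m N es s \<Longrightarrow> stamps_le_clock m N s"
proof (induction rule: run.induct)
  case start
  show ?case by (simp add: stamps_le_clock_def initial_def)
qed (rule step_stamps_le_clock)

text \<open>Dual to the upper bound: the partial sum plus the current contents of the unread cells
  never drops below \<open>T\<close>. Only the call \<open>(k, x)\<close> is constrained, since
  other calls may have read cells before the clock reached \<open>T\<close>. The clause on the clock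
  supplies the bound when this call takes its stamp or starts summing.\<close>

definition stamps_ge :: "mode \<Rightarrow> nat \<Rightarrow> nat \<Rightarrow> tag \<Rightarrow> 'id \<Rightarrow> 'id state \<Rightarrow> bool" where
  "stamps_ge m N T k x s \<longleftrightarrow> T \<le> clock m N s \<and>
    (\<forall>p t. (k, x, t) \<in> set (reg s p) \<longrightarrow> T \<le> t) \<and>
    (\<forall>p t. ctrl s p = Stamped k x t \<longrightarrow> T \<le> t) \<and>
    (\<forall>p D v. ctrl s p = Summing k x D v \<longrightarrow> finite D \<and> T \<le> v + sum (cell s) D)"

lemma step_stamps_ge:
  assumes "step m N s e s'" and "stamps_ge m N T k x s"
  shows "stamps_ge m N T k x s'"
proof -
  note inv = assms(2)[unfolded stamps_ge_def]
  have T: "T \<le> clock m N s'"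
    using step_clock_mono[OF assms(1)] inv by simp
  from assms(1) show ?thesis
  proof cases
    case (inc_cell p k' x')
    have "T \<le> v + sum (cell s') D" if "T \<le> v + sum (cell s) D" for v D
      using that sum_upd_le[of "cell s" D p] inc_cell by simp
    \<comment> \<open>The incrementing process starts with partial sum \<open>0\<close> and all
      cells unread, so its bound is the one on the clock.\<close>
    moreover have "T \<le> sum (cell s') {1..N}"
      using T inc_cell by (simp add: clock_def)
    ultimately show ?thesis
      using inv T inc_cell unfolding stamps_ge_def by auto
  next
    case (read_cell p k' x' D v j)
    \<comment> \<open>A read moves the value of cell \<open>j\<close> from the unread part to the
      partial sum and leaves the total unchanged.\<close>
    have "T \<le> v + cell s j + sum (cell s) (D - {j})" "finite D" if "k' = k" "x' = x"
      using inv read_cell that sum.remove[of D j "cell s"] by fastforce+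
    then show ?thesis
      using inv T read_cell unfolding stamps_ge_def by auto
  next
    case (return_sum p k' x' v)
    have "T \<le> v" if "k' = k" "x' = x"
      using inv return_sum that by fastforce
    then show ?thesis
      using inv T return_sum unfolding stamps_ge_def by auto
  next
    case (fetch_inc p k' x')
    \<comment> \<open>The stamp is the clock before the increment, so the bound at the old state is
      needed; the one at \<open>s'\<close> would be too weak by one.\<close>
    have "T \<le> counter s" using inv fetch_inc by (simp add: clock_def)
    then show ?thesis
      using inv T fetch_inc unfolding stamps_ge_def by auto
  qed (use inv T in \<open>auto simp: stamps_ge_def\<close>)
qed

text \<open>Absence of pending calls makes the bound inductive: a new record needs a pending call,
  and a pending call can reappear only through \<open>Call_Add k x\<close>.\<close>

definition records_le :: "nat \<Rightarrow> tag \<Rightarrow> 'id \<Rightarrow> 'id state \<Rightarrow> bool" where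
  "records_le T k x s \<longleftrightarrow> (\<forall>p. (k, x) \<notin> pending (ctrl s p)) \<and>
    (\<forall>p t. (k, x, t) \<in> set (reg s p) \<longrightarrow> t \<le> T)"

lemma step_records_le:
  assumes "step m N s e s'" and "snd e \<noteq> Call_Add k x" and "records_le T k x s"
  shows "records_le T k x s'"
proof -
  have "(k, x) \<notin> pending (ctrl s' p)" for p
    using step_pending[OF assms(1), of k x p] assms(2,3) by (auto simp: records_le_def)
  moreover have "t \<le> T" if "(k, x, t) \<in> set (reg s' p)" for p t
    using step_record[OF assms(1) that] assms(3)
    by (metis records_le_def insertI1 pending.simps(3))
  ultimately show ?thesis by (simp add: records_le_def)
qed

text \<open>The clock at the cut between \<open>us\<close> and \<open>vs\<close> separates the
  stamps: one call is over by then and the other has not started.\<close>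

lemma stamp_le_of_return_before_call:
  assumes run: "run m N (us @ vs) s"
    and once: "at_most_once (us @ vs) (Call_Add k x)"
    and ret: "Ret_Add k x \<in> actions us"
    and not_called: "Call_Add l y \<notin> actions us"
    and rec: "(k, x, t) \<in> set (reg s p)" "(l, y, u) \<in> set (reg s q)"
  shows "t \<le> u"
proof -
  from run obtain s0 where s0: "run m N us s0"
    and invariant: "\<And>P. P s0 \<Longrightarrow>
      (\<And>s e s'. e \<in> set vs \<Longrightarrow> step m N s e s' \<Longrightarrow> P s \<Longrightarrow> P s') \<Longrightarrow> P s"
    using run_append_invariant by blast
  define T where "T = clock m N s0"
  have "records_le T k x s"
  proof (rule invariant)
    have "(k, x) \<notin> pending (ctrl s0 p)" for p
      using not_pending_after_return[OF s0 at_most_once_prefix[OF once], of p] ret by blast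
    moreover have "t \<le> T" if "(k, x, t) \<in> set (reg s0 p)" for p t
      using run_stamps_le_clock[OF s0] that unfolding stamps_le_clock_def T_def by blast
    ultimately show "records_le T k x s0"
      by (simp add: records_le_def)
  next
    fix a e b
    assume e: "e \<in> set vs" "step m N a e b" "records_le T k x a"
    \<comment> \<open>The return in \<open>us\<close> presupposes a call in \<open>us\<close>, and
      the call is made at most once.\<close>
    have "Call_Add k x \<notin> actions vs"
      using at_most_once_appendD[OF once] call_of_append_or_return(2)[OF s0 ret] .
    then have "snd e \<noteq> Call_Add k x"
      using e(1) by (metis image_eqI)
    then show "records_le T k x b"
      using step_records_le[OF e(2) _ e(3)] by simp
  qed
  moreover have "stamps_ge m N T l y s"
  proof (rule invariant)
    \<comment> \<open>Before its call, \<open>(l, y)\<close> has neither a record nor a control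
      state, so all clauses but the one on the clock hold vacuously, and that one is an
      equality.\<close>
    have "(l, y) \<notin> pending (ctrl s0 p)" "(l, y, t) \<notin> set (reg s0 p)" for p t
      using call_of_pending_or_record[OF s0, of l y p t] not_called by simp_all
    moreover from this have "ctrl s0 p \<noteq> Stamped l y t" "ctrl s0 p \<noteq> Summing l y D v" for p t D v
      by (metis insertI1 pending.simps(3), metis insertI1 pending.simps(2))
    ultimately show "stamps_ge m N T l y s0"
      unfolding stamps_ge_def T_def by simp
  qed (rule step_stamps_ge)
  ultimately show ?thesis
    using rec unfolding records_le_def stamps_ge_def by (blast intro: order_trans)
qed

section \<open>From a true answer to the real-time order\<close>

lemma nth_of_actions:
  assumes "a \<in> actions es"
  obtains i p where "i < length es" "es ! i = (p, a)"
  using assms by (auto simp: in_set_conv_nth)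

lemma actions_take: "i < j \<Longrightarrow> j < length es \<Longrightarrow> es ! i = (p, a) \<Longrightarrow> a \<in> actions (take j es)"
  by (force simp: in_set_conv_nth)

theorem theorem15:
  fixes m :: mode and N :: nat and es :: "'id event list"
  assumes "execution m N es"
    and "operations_wf es"
    and "external_placement es"
  shows "\<forall>A B. (\<exists>p. (p, Ret_Precedes A B True) \<in> set es) \<longrightarrow> real_time_before es A B"
proof (intro allI impI)
  fix A B
  assume "\<exists>p. (p, Ret_Precedes A B True) \<in> set es"
  then have answer: "Ret_Precedes A B True \<in> actions es" by force
  from assms(1) obtain s where run: "run m N es s"
    unfolding execution_def by blast
  note placed = assms(3)[unfolded external_placement_def]
  note once = placed[THEN conjunct1, rule_format]
  note inv_after = placed[THEN conjunct2, THEN conjunct1, rule_format]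
  note call_after = placed[THEN conjunct2, THEN conjunct2, THEN conjunct1, rule_format]
  note query_after = placed[THEN conjunct2, THEN conjunct2, THEN conjunct2, rule_format]
  note res_after = assms(2)[unfolded operations_wf_def, THEN conjunct2, rule_format]
  from answer_true[OF run answer] obtain tA tB i j where
    query: "Call_Precedes A B \<in> actions es" and less: "tA < tB" and
    rec: "(R, A, tA) \<in> set (reg s i)" "(I, B, tB) \<in> set (reg s j)"
    by blast
  have "Call_Add R A \<in> actions es"
    using call_of_pending_or_record[OF run, of R A i tA] rec(1) by simp
  then obtain c pA where c: "c < length es" "es ! c = (pA, Call_Add R A)"
    by (rule nth_of_actions)
  then obtain a where a: "a < c" "es ! a = (pA, Res A)"
    using call_after by blast
  \<comment> \<open>The record of \<open>(I, B)\<close> does not show that \<open>B\<close> was ever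
    invoked, since \<open>Add_Inv\<close> returns before the invocation. The invocation is reached
    from the response record of \<open>B\<close>, which the query presupposes: back to its
    \<open>Add_Res\<close> call, the response and finally the invocation.\<close>
  from query obtain k p where k: "k < length es" "es ! k = (p, Call_Precedes A B)"
    by (rule nth_of_actions)
  then obtain r q t where "r < k" "es ! r = (q, Append (R, B, t))"
    using query_after[OF k] by blast
  then have "Append (R, B, t) \<in> actions (take k es)"
    using actions_take k(1) by blast
  then have "Append (R, B, t) \<in> actions es"
    by (blast dest: in_set_takeD)
  then have "Call_Add R B \<in> actions es"
    by (rule call_of_append_or_return(1)[OF run])
  then obtain d' qB where d': "d' < length es" "es ! d' = (qB, Call_Add R B)"
    by (rule nth_of_actions)
  then obtain d where "d < d'" "es ! d = (qB, Res B)"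
    using call_after by blast
  then obtain b where "b < d" "es ! b = (qB, Inv B)"
    using res_after[of d qB B] d'(1) by auto
  then have b: "b < length es" "es ! b = (qB, Inv B)"
    using \<open>d < d'\<close> d'(1) by auto
  have "a < b"
  proof (rule ccontr)
    assume "\<not> a < b"
    \<comment> \<open>The run is cut just before \<open>Inv B\<close>, at position \<open>b\<close>:
      \<open>Add_Inv\<close> of \<open>B\<close> has returned in the first part, and
      \<open>Add_Res\<close> of \<open>A\<close> is called in the second, at offset
      \<open>c - b\<close>.\<close>
    then have "b < c" using a(1) by simp
    obtain e where "e < b" "es ! e = (qB, Ret_Add I B)"
      using inv_after[OF b] by blast
    then have returned: "Ret_Add I B \<in> actions (take b es)"
      using b(1) actions_take by blast
    have "(pA, Call_Add R A) \<in> set (drop b es)"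
      using c \<open>b < c\<close> by (auto simp: in_set_conv_nth intro!: exI[of _ "c - b"])
    then have "Call_Add R A \<in> actions (drop b es)"
      by force
    then have not_called: "Call_Add R A \<notin> actions (take b es)"
      using at_most_once_appendD[of "take b es" "drop b es"] once
        append_take_drop_id[of b es] by metis
    \<comment> \<open>The records enter in swapped order, because here the call for \<open>B\<close>
      is the finished one.\<close>
    have "tB \<le> tA"
      using stamp_le_of_return_before_call[of m N "take b es" "drop b es" s,
          OF _ _ returned not_called rec(2,1)] run once
      by simp
    with less show False by simp
  qed
  then show "real_time_before es A B"
    using a(2) b unfolding real_time_before_def by blast
qed

end
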